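(* Let $P$ be a Markov kernel on a finite state space $S$ with $|S|\ge2$ and stationary distribution $\pi$ of full support. Then $$\mathrm{Var}_\pi(r):=\sum_{x\in S}\pi(x)\bigl(r(x)-\bar r_\pi\bigr)^2\le\bar r_\pi\,M\,(1-L(P)).$$ This bound is sharp: equality holds for any chain in which $r(x)\in\{0,M\}$ for $\pi$-a.e. $x$.
   Context: All logarithms are natural, with $0\log0=0$. $D_{\mathrm{KL}}(\mu\|\nu)=\sum_{x\in S}\mu(x)\log\frac{\mu(x)}{\nu(x)}$. The local KL retention ratio is $r(x):=D_{\mathrm{KL}}(P(x,\cdot)\|\pi)/\log(1/\pi(x))$; $\bar r_\pi:=\sum_{x\in S}\pi(x)r(x)$; $M:=\max_{x\in S}r(x)$; the localization ratio is $L(P):=\bar r_\pi/M$, with the convention $L(P)=1$ when $\bar r_\pi=M=0$. *)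

theory Defs
  imports "HOL-Probability.Probability_Mass_Function"
begin

text \<open>
  The finite state space is a type of class \<open>finite\<close>, and a Markov kernel on it is a function
  \<open>P :: 'a \<Rightarrow> 'a pmf\<close>, so that \<open>pmf (P x) y\<close> is the transition probability $P(x,y)$.
\<close>

definition stationary :: "('a \<Rightarrow> 'a pmf) \<Rightarrow> 'a pmf \<Rightarrow> bool" where
  "stationary P \<pi> \<longleftrightarrow> bind_pmf \<pi> P = \<pi>"

text \<open>
  Terms with \<open>pmf \<mu> x = 0\<close> vanish, in accordance with $0\log 0=0$. When \<open>pmf \<nu> x = 0\<close> but
  \<open>pmf \<mu> x \<noteq> 0\<close>, division by zero would give a junk value instead of $+\infty$; the definition is
  meant for \<open>\<nu>\<close> of full support only.
\<close>

definition KL_div :: "'a::finite pmf \<Rightarrow> 'a pmf \<Rightarrow> real" where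
  "KL_div \<mu> \<nu> = (\<Sum>x\<in>UNIV. pmf \<mu> x * ln (pmf \<mu> x / pmf \<nu> x))"

definition retention :: "('a::finite \<Rightarrow> 'a pmf) \<Rightarrow> 'a pmf \<Rightarrow> 'a \<Rightarrow> real" where
  "retention P \<pi> x = KL_div (P x) \<pi> / ln (1 / pmf \<pi> x)"

definition mean_retention :: "('a::finite \<Rightarrow> 'a pmf) \<Rightarrow> 'a pmf \<Rightarrow> real" where
  "mean_retention P \<pi> = (\<Sum>x\<in>UNIV. pmf \<pi> x * retention P \<pi> x)"

definition max_retention :: "('a::finite \<Rightarrow> 'a pmf) \<Rightarrow> 'a pmf \<Rightarrow> real" where
  "max_retention P \<pi> = Max (range (retention P \<pi>))"

definition localization_ratio :: "('a::finite \<Rightarrow> 'a pmf) \<Rightarrow> 'a pmf \<Rightarrow> real" where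
  "localization_ratio P \<pi> =
     (if mean_retention P \<pi> = 0 \<and> max_retention P \<pi> = 0 then 1
      else mean_retention P \<pi> / max_retention P \<pi>)"

definition var_retention :: "('a::finite \<Rightarrow> 'a pmf) \<Rightarrow> 'a pmf \<Rightarrow> real" where
  "var_retention P \<pi> = (\<Sum>x\<in>UNIV. pmf \<pi> x * (retention P \<pi> x - mean_retention P \<pi>)\<^sup>2)"

end

(* Gibbs' inequality gives r \<ge> 0, so r^2 \<le> M * r pointwise, with equality exactly where
   r is 0 or M. Taking the mean and subtracting m^2, where m is the mean of r, yields
   Var r \<le> m * (M - m). *)
theory Submission
  imports Defs
begin

lemma sum_pmf_UNIV: "(\<Sum>x\<in>UNIV. pmf p x) = 1" for p :: "'a::finite pmf"
  by (rule sum_pmf_eq_1) auto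

text \<open>Gibbs' inequality: \<open>ln t \<le> t - 1\<close> at
  \<open>t = pmf \<nu> x / pmf \<mu> x\<close> bounds each summand below by
  \<open>pmf \<mu> x - pmf \<nu> x\<close>, and these differences sum to 1 - 1 = 0. Full support of
  \<open>\<nu>\<close> keeps the logarithms meaningful.\<close>

lemma KL_div_nonneg:
  fixes \<mu> \<nu> :: "'a::finite pmf"
  assumes "set_pmf \<nu> = UNIV"
  shows "KL_div \<mu> \<nu> \<ge> 0"
proof -
  have "pmf \<mu> x - pmf \<nu> x \<le> pmf \<mu> x * ln (pmf \<mu> x / pmf \<nu> x)" for x
  \<comment> \<open>Where \<open>pmf \<mu> x = 0\<close>, the claim is just
    \<open>- pmf \<nu> x \<le> 0\<close>.\<close>
  proof (cases "pmf \<mu> x = 0")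
    case False
    then have \<mu>: "pmf \<mu> x > 0"
      by (simp add: pmf_pos)
    have \<nu>: "pmf \<nu> x > 0"
      using assms by (simp add: pmf_positive)
    have "ln (pmf \<nu> x / pmf \<mu> x) \<le> pmf \<nu> x / pmf \<mu> x - 1"
      using \<mu> \<nu> by (intro ln_le_minus_one) simp
    then have "1 - pmf \<nu> x / pmf \<mu> x \<le> ln (pmf \<mu> x / pmf \<nu> x)"
      using \<mu> \<nu> by (simp add: ln_div)
    then have "pmf \<mu> x * (1 - pmf \<nu> x / pmf \<mu> x) \<le> pmf \<mu> x * ln (pmf \<mu> x / pmf \<nu> x)"
      using \<mu> by (intro mult_left_mono) auto
    then show ?thesis
      using \<mu> by (simp add: algebra_simps)
  qed simp
  then have "(\<Sum>x\<in>UNIV. pmf \<mu> x - pmf \<nu> x) \<le> KL_div \<mu> \<nu>"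
    unfolding KL_div_def by (rule sum_mono)
  then show ?thesis
    by (simp add: sum_subtractf sum_pmf_UNIV)
qed

lemma retention_nonneg:
  assumes "set_pmf \<pi> = UNIV"
  shows "retention P \<pi> x \<ge> 0"
proof -
  have "pmf \<pi> x > 0"
    using assms by (simp add: pmf_positive)
  \<comment> \<open>A nonnegative denominator suffices: were it 0, the quotient would be 0 by the
    convention \<open>a / 0 = 0\<close>.\<close>
  then have "ln (1 / pmf \<pi> x) \<ge> 0"
    by (intro ln_ge_zero) (simp add: pmf_le_1)
  with KL_div_nonneg[OF assms] show ?thesis
    by (simp add: retention_def)
qed

lemma retention_le_max: "retention P \<pi> x \<le> max_retention P \<pi>"
  by (simp add: max_retention_def)

lemma var_retention_eq:
  "var_retention P \<pi> =
     (\<Sum>x\<in>UNIV. pmf \<pi> x * (retention P \<pi> x)\<^sup>2) - (mean_retention P \<pi>)\<^sup>2"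
proof -
  let ?r = "retention P \<pi>" and ?m = "mean_retention P \<pi>"
  have "var_retention P \<pi> =
      (\<Sum>x\<in>UNIV. pmf \<pi> x * (?r x)\<^sup>2 - 2 * ?m * (pmf \<pi> x * ?r x) + ?m\<^sup>2 * pmf \<pi> x)"
    unfolding var_retention_def by (simp add: power2_diff algebra_simps)
  also have "\<dots> = (\<Sum>x\<in>UNIV. pmf \<pi> x * (?r x)\<^sup>2)
      - 2 * ?m * (\<Sum>x\<in>UNIV. pmf \<pi> x * ?r x) + ?m\<^sup>2 * (\<Sum>x\<in>UNIV. pmf \<pi> x)"
    by (simp add: sum.distrib sum_subtractf sum_distrib_left)
  also have "\<dots> = (\<Sum>x\<in>UNIV. pmf \<pi> x * (?r x)\<^sup>2) - ?m\<^sup>2"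
    by (simp add: sum_pmf_UNIV flip: mean_retention_def) (simp add: power2_eq_square)
  finally show ?thesis .
qed

text \<open>Brings the bound into the shape of \<open>var_retention_eq\<close>, with M * r in place
  of r^2, so that the two can be compared term by term. For nonzero M it is m * M * (1 - m / M) = M
  * m - m^2, where M * m is the mean of M * r.\<close>

lemma mean_max_localization:
  assumes "set_pmf \<pi> = UNIV"
  shows "mean_retention P \<pi> * max_retention P \<pi> * (1 - localization_ratio P \<pi>) =
    (\<Sum>x\<in>UNIV. pmf \<pi> x * (max_retention P \<pi> * retention P \<pi> x)) - (mean_retention P \<pi>)\<^sup>2"
proof -
  \<comment> \<open>If M = 0, then r is squeezed between 0 and M, so the mean vanishes too. The
    localization ratio is then 1 by convention, and both sides are 0.\<close>
  have "mean_retention P \<pi> = 0" if "max_retention P \<pi> = 0"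
  proof -
    have "retention P \<pi> x = 0" for x
      using that retention_nonneg[OF assms, of P x] retention_le_max[of P \<pi> x] by simp
    then show ?thesis
      by (simp add: mean_retention_def)
  qed
  moreover have "(\<Sum>x\<in>UNIV. pmf \<pi> x * (max_retention P \<pi> * retention P \<pi> x)) =
      max_retention P \<pi> * mean_retention P \<pi>"
    by (simp add: mean_retention_def sum_distrib_left mult.left_commute)
  ultimately show ?thesis
    by (cases "max_retention P \<pi> = 0")
       (auto simp: localization_ratio_def field_simps power2_eq_square)
qed

theorem proposition4p1:
  fixes P :: "'a::finite \<Rightarrow> 'a pmf" and \<pi> :: "'a pmf"
  assumes "CARD('a) \<ge> 2"
    and "stationary P \<pi>"
    and "set_pmf \<pi> = UNIV"
  shows "var_retention P \<pi>
           \<le> mean_retention P \<pi> * max_retention P \<pi> * (1 - localization_ratio P \<pi>) \<and>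
         ((AE x in measure_pmf \<pi>. retention P \<pi> x \<in> {0, max_retention P \<pi>}) \<longrightarrow>
          var_retention P \<pi>
            = mean_retention P \<pi> * max_retention P \<pi> * (1 - localization_ratio P \<pi>))"
proof (intro conjI impI)
  have "(retention P \<pi> x)\<^sup>2 \<le> max_retention P \<pi> * retention P \<pi> x" for x
    unfolding power2_eq_square
    by (intro mult_right_mono retention_le_max retention_nonneg assms(3))
  \<comment> \<open>After rewriting, both sides subtract the same squared mean, so the pointwise
    bound is summed with the nonnegative weights \<open>pmf \<pi> x\<close>.\<close>
  then show "var_retention P \<pi>
      \<le> mean_retention P \<pi> * max_retention P \<pi> * (1 - localization_ratio P \<pi>)"
    unfolding var_retention_eq mean_max_localization[OF assms(3)]
    by (intro diff_right_mono sum_mono mult_left_mono) auto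
next
  assume "AE x in measure_pmf \<pi>. retention P \<pi> x \<in> {0, max_retention P \<pi>}"
  \<comment> \<open>Every point has positive mass, so almost everywhere means everywhere.\<close>
  then have "retention P \<pi> x \<in> {0, max_retention P \<pi>}" for x
    using assms(3) by (simp add: AE_measure_pmf_iff)
  then have "(retention P \<pi> x)\<^sup>2 = max_retention P \<pi> * retention P \<pi> x" for x
    by (metis empty_iff insert_iff mult_zero_right power2_eq_square)
  then show "var_retention P \<pi>
      = mean_retention P \<pi> * max_retention P \<pi> * (1 - localization_ratio P \<pi>)"
    unfolding var_retention_eq mean_max_localization[OF assms(3)] by simp
qed

end
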